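(* Let $\Theta$ be a finite set, $1\le T\le\infty$, $\mu\in\operatorname{int}\Delta(\Theta)$ a prior, and let $\delta\in[0,1]$ if $T<\infty$ and $\delta\in[0,1)$ if $T=\infty$. Let $\xi:\Theta\to\Delta(Z)$ be a non-trivial static information structure with $Z$ finite, and let $H$ and $P$ be cdfs of random arrival times supported on $\{1,\dots,T\}$. Let $\pi_1$ (respectively $\pi_2$) be the dynamic information structure in which the realization of $\xi$ arrives at a random time with cdf $H$ (respectively $P$) and no other information arrives. If $P$ second-order stochastically dominates $H$, then $\pi_1$ dominates $\pi_2$ in the class of $\delta$-discounted problems, i.e. $W(\pi_1)\ge W(\pi_2)$ for every $\delta$-discounted problem with state space $\Theta$ and horizon $T$.
   Context: Periods are $t\in\{1,\dots,T\}$ (all positive integers if $T=\infty$). $\Delta(X)$ denotes the probability measures on $X$. Convention: $0^0=1$. Let $\rho\in\Delta(\Delta(\Theta))$ be the (finitely supported) law of the posterior about $\theta$ after observing $z\sim\xi(\cdot\mid\theta)$ with $\theta\sim\mu$. Non-trivial means that $\rho$ is not the point mass $\delta_\mu$ at the prior. Random arrival: an arrival time $Y$ with values in $\{1,\dots,T\}$ and the given cdf is drawn independently of $(\theta,z)$. The agent observes $z$ in period $Y$ (before acting) and an uninformative null signal in every other period. The period-$t$ distribution over posteriors is the law of the belief about $\theta$ given everything observed in periods $1,\dots,t$; it is $F_t=H(t)\rho+(1-H(t))\delta_\mu$ under $\pi_1$ and $G_t=P(t)\rho+(1-P(t))\delta_\mu$ under $\pi_2$ ($\delta_\mu$ is a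 point mass, not to be confused with the discount factor $\delta$). $P$ second-order stochastically dominates $H$ means that a random variable with cdf $H$ is a mean-preserving spread of one with cdf $P$: there are random variables $Y_1$ with cdf $H$, $Y_2$ with cdf $P$, and an integrable $W$, on a common probability space, with $Y_1=Y_2+W$ and $\mathbb{E}[W\mid Y_2]=0$. $\delta$-discounted problem (for the given $\delta$): a nonempty compact action set $A^*$, available in every period, and a continuous $v:A^*\times\Theta\to\mathbb{R}$; the total utility is $\sum_{t=1}^T\delta^{t-1}v(a_t,\theta)$. Value of a signal: put $V(x)=\max_{a\in A^*}\sum_\theta x(\theta)v(a,\theta)$ for $x\in\Delta(\Theta)$. The agent's optimal ex ante expected utility is $W(\pi_1)=\sum_{t=1}^T\delta^{t-1}\,\mathbb{E}_{x\sim F_t}[V(x)]$ and $W(\pi_2)=\sum_{t=1}^T\delta^{t-1}\,\mathbb{E}_{x\sim G_t}[V(x)]$. *)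

theory Defs
  imports "HOL-Probability.Probability"
begin

text \<open>
  The state space and the set of static signals are finite types. Beliefs about the state
  are elements of \<^typ>\<open>'th pmf\<close>, and laws of beliefs are elements of \<^typ>\<open>'th pmf pmf\<close>.
\<close>

definition joint_law :: "'th pmf \<Rightarrow> ('th \<Rightarrow> 's pmf) \<Rightarrow> ('th \<times> 's) pmf" where
  "joint_law \<mu> \<xi> = bind_pmf \<mu> (\<lambda>\<theta>. map_pmf (Pair \<theta>) (\<xi> \<theta>))"

text \<open>
  This is meaningful only for signals of positive probability; the other signals play no
  role in the law of the posterior defined next.
\<close>

definition posterior :: "'th pmf \<Rightarrow> ('th \<Rightarrow> 's pmf) \<Rightarrow> 's \<Rightarrow> 'th pmf" where
  "posterior \<mu> \<xi> s = map_pmf fst (cond_pmf (joint_law \<mu> \<xi>) {\<omega>. snd \<omega> = s})"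

definition posterior_law :: "'th pmf \<Rightarrow> ('th \<Rightarrow> 's pmf) \<Rightarrow> 'th pmf pmf" where
  "posterior_law \<mu> \<xi> = map_pmf (\<lambda>\<omega>. posterior \<mu> \<xi> (snd \<omega>)) (joint_law \<mu> \<xi>)"

definition nontrivial_info :: "'th pmf \<Rightarrow> ('th \<Rightarrow> 's pmf) \<Rightarrow> bool" where
  "nontrivial_info \<mu> \<xi> \<longleftrightarrow> posterior_law \<mu> \<xi> \<noteq> return_pmf \<mu>"

definition periods :: "enat \<Rightarrow> nat set" where
  "periods T = {t. 1 \<le> t \<and> enat t \<le> T}"

text \<open>
  A dynamic information structure maps each state to the law of a signal path; the value of
  a path at \<open>t\<close> is the signal of period \<open>t\<close>. Values outside the periods are never used.
  Discrete path laws suffice, since under random arrival the path is a function of the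
  static signal and the arrival time.
\<close>

type_synonym ('th, 's) dynamic_info = "'th \<Rightarrow> (nat \<Rightarrow> 's) pmf"

definition history :: "nat \<Rightarrow> (nat \<Rightarrow> 's) \<Rightarrow> 's list" where
  "history t s = map s [1..<Suc t]"

definition belief_law :: "'th pmf \<Rightarrow> ('th, 's) dynamic_info \<Rightarrow> nat \<Rightarrow> 'th pmf pmf" where
  "belief_law \<mu> \<pi> t = posterior_law \<mu> (\<lambda>\<theta>. map_pmf (history t) (\<pi> \<theta>))"

text \<open>The null signal is \<^const>\<open>None\<close>; the arrival time is independent of state and signal.\<close>

definition random_arrival :: "('th \<Rightarrow> 'z pmf) \<Rightarrow> nat pmf \<Rightarrow> ('th, 'z option) dynamic_info" where
  "random_arrival \<xi> q =
     (\<lambda>\<theta>. map_pmf (\<lambda>(z, y) t. if t = y then Some z else None) (pair_pmf (\<xi> \<theta>) q))"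

definition arrival_cdf :: "nat pmf \<Rightarrow> real \<Rightarrow> real" where
  "arrival_cdf q = cdf (distr (measure_pmf q) borel real)"

text \<open>
  \<open>P\<close> second-order stochastically dominates \<open>H\<close>. HOL cannot quantify existentially over the
  type carrying the common probability space, so this type is a parameter. When the
  predicate is a hypothesis with a free type variable there, every probability space is allowed.
\<close>

definition second_order_dominates ::
    "'w itself \<Rightarrow> (real \<Rightarrow> real) \<Rightarrow> (real \<Rightarrow> real) \<Rightarrow> bool" where
  "second_order_dominates (_ :: 'w itself) P H \<longleftrightarrow>
     (\<exists>(M :: 'w measure) Y1 Y2 W.
        prob_space M \<and>
        Y1 \<in> borel_measurable M \<and> cdf (distr M borel Y1) = H \<and>
        Y2 \<in> borel_measurable M \<and> cdf (distr M borel Y2) = P \<and>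
        integrable M W \<and>
        (AE \<omega> in M. Y1 \<omega> = Y2 \<omega> + W \<omega>) \<and>
        (AE \<omega> in M. real_cond_exp M (vimage_algebra (space M) Y2 borel) W \<omega> = 0))"

text \<open>
  The state space is finite and discrete, so joint continuity of \<open>v\<close> is continuity in the
  action for each state.
\<close>

definition decision_problem :: "'a::topological_space set \<Rightarrow> ('a \<Rightarrow> 'th \<Rightarrow> real) \<Rightarrow> bool" where
  "decision_problem A v \<longleftrightarrow> A \<noteq> {} \<and> compact A \<and> (\<forall>\<theta>. continuous_on A (\<lambda>a. v a \<theta>))"

text \<open>For a decision problem this supremum is attained, i.e. it is the maximum.\<close>

definition indirect_utility ::
    "'a set \<Rightarrow> ('a \<Rightarrow> 'th::finite \<Rightarrow> real) \<Rightarrow> 'th pmf \<Rightarrow> real" where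
  "indirect_utility A v x = (SUP a\<in>A. \<Sum>\<theta>\<in>UNIV. pmf x \<theta> * v a \<theta>)"

text \<open>
  For \<open>T = \<infinity>\<close> and \<open>0 \<le> \<delta> < 1\<close> the series converges absolutely, since the indirect utility of
  a decision problem is bounded.
\<close>

definition discounted_value ::
    "'th::finite pmf \<Rightarrow> enat \<Rightarrow> real \<Rightarrow> 'a set \<Rightarrow> ('a \<Rightarrow> 'th \<Rightarrow> real) \<Rightarrow>
       ('th, 's) dynamic_info \<Rightarrow> real" where
  "discounted_value \<mu> T \<delta> A v \<pi> =
     (\<Sum>\<^sub>\<infinity>t\<in>periods T. \<delta> ^ (t - 1) *
        measure_pmf.expectation (belief_law \<mu> \<pi> t) (indirect_utility A v))"

end

theory Submission
  imports Defs
begin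

text \<open>
  Beliefs follow a martingale, so the convexity of the indirect utility makes the gain \<open>C\<close> from
  observing the signal nonnegative. The value of a random arrival time with cdf \<open>Q\<close> is a constant
  plus \<open>C\<close> times the sum of \<open>\<delta>\<^sup>t\<^sup>-\<^sup>1 Q(t)\<close>. A mean-preserving spread increases the expectation of the
  convex function \<open>y \<mapsto> max 0 (k - y)\<close>, which for arrival times is the sum of \<open>Q(t)\<close> over \<open>t < k\<close>;
  summation by parts with the decreasing weights \<open>\<delta>\<^sup>t\<^sup>-\<^sup>1\<close> turns this into the claim.
\<close>

section \<open>Bayes' rule for static signals\<close>

lemma pmf_joint_law: "pmf (joint_law \<mu> \<xi>) (\<theta>, s) = pmf \<mu> \<theta> * pmf (\<xi> \<theta>) s"
proof -
  have "pmf (map_pmf (Pair \<eta>) (\<xi> \<eta>)) (\<theta>, s) = indicator {\<theta>} \<eta> * pmf (\<xi> \<theta>) s" for \<eta>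
    by (cases "\<eta> = \<theta>") (auto simp: pmf_map_inj' inj_def pmf_eq_0_set_pmf)
  then show ?thesis
    by (simp add: joint_law_def pmf_bind measure_pmf_single)
qed

lemma measure_joint_law_signal:
  fixes \<mu> :: "'th::finite pmf"
  shows "measure_pmf.prob (joint_law \<mu> \<xi>) {\<omega>. snd \<omega> = s} = (\<Sum>\<theta>\<in>UNIV. pmf \<mu> \<theta> * pmf (\<xi> \<theta>) s)"
proof -
  have "{\<omega>. snd \<omega> = s} = (\<lambda>\<theta>::'th. (\<theta>, s)) ` UNIV"
    by auto
  then show ?thesis
    by (simp add: measure_measure_pmf_finite sum.reindex inj_on_def pmf_joint_law)
qed

text \<open>Bayes' rule. The state \<open>\<eta>\<close> witnesses that \<open>s\<close> has
  positive probability, so that \<open>cond_pmf\<close> conditions on a non-null event.\<close>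

lemma pmf_posterior:
  fixes \<mu> :: "'th::finite pmf"
  assumes "\<eta> \<in> set_pmf \<mu>" "s \<in> set_pmf (\<xi> \<eta>)"
  shows "pmf (posterior \<mu> \<xi> s) \<theta> =
    pmf \<mu> \<theta> * pmf (\<xi> \<theta>) s / (\<Sum>\<theta>'\<in>UNIV. pmf \<mu> \<theta>' * pmf (\<xi> \<theta>') s)"
proof -
  let ?S = "{\<omega> :: 'th \<times> _. snd \<omega> = s}"
  let ?C = "cond_pmf (joint_law \<mu> \<xi>) ?S"
  have "(\<eta>, s) \<in> set_pmf (joint_law \<mu> \<xi>)"
    using assms by (auto simp: joint_law_def)
  then have ne: "set_pmf (joint_law \<mu> \<xi>) \<inter> ?S \<noteq> {}"
    by auto
  have "pmf (posterior \<mu> \<xi> s) \<theta> = measure_pmf.prob ?C (fst -` {\<theta>})"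
    by (simp add: posterior_def pmf_map)
  \<comment> \<open>The two events differ only by pairs whose second component is not
    \<open>s\<close>, and these are null after conditioning.\<close>
  also have "\<dots> = measure_pmf.prob ?C {(\<theta>, s)}"
    using set_cond_pmf[OF ne] by (intro measure_prob_cong_0) (auto simp: pmf_eq_0_set_pmf)
  also have "\<dots> = pmf ?C (\<theta>, s)"
    by (simp add: measure_pmf_single)
  finally show ?thesis
    by (simp add: pmf_cond[OF ne] pmf_joint_law measure_joint_law_signal)
qed

text \<open>A likelihood factor \<open>c\<close> that does not depend on the state cancels between
  numerator and denominator of Bayes' rule. This allows signals of different types and from
  different information structures to be compared.\<close>

lemma posterior_proportional:
  fixes \<mu> :: "'th::finite pmf"
  assumes "\<eta> \<in> set_pmf \<mu>" "s \<in> set_pmf (\<xi> \<eta>)"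
    and proportional: "\<And>\<theta>. pmf (\<xi> \<theta>) s = c * pmf (\<xi>' \<theta>) s'"
  shows "posterior \<mu> \<xi> s = posterior \<mu> \<xi>' s'"
proof (rule pmf_eqI)
  fix \<theta>
  have "pmf (\<xi> \<eta>) s > 0"
    using assms(2) by (simp add: pmf_positive)
  then have "c \<noteq> 0" and "s' \<in> set_pmf (\<xi>' \<eta>)"
    using proportional[of \<eta>] by (auto simp: set_pmf_iff)
  then show "pmf (posterior \<mu> \<xi> s) \<theta> = pmf (posterior \<mu> \<xi>' s') \<theta>"
    using assms by (simp add: pmf_posterior proportional mult.left_commute flip: sum_distrib_left)
qed

lemma posterior_uninformative:
  fixes \<mu> :: "'th::finite pmf"
  shows "posterior \<mu> (\<lambda>_. return_pmf s) s = \<mu>"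
proof (rule pmf_eqI)
  fix \<theta>
  obtain \<eta> where "\<eta> \<in> set_pmf \<mu>"
    using set_pmf_not_empty[of \<mu>] by blast
  then show "pmf (posterior \<mu> (\<lambda>_. return_pmf s) s) \<theta> = pmf \<mu> \<theta>"
    by (simp add: pmf_posterior sum_pmf_eq_1)
qed

section \<open>Posteriors and belief laws under random arrival\<close>

lemma history_eq_iff: "history t s = history t s' \<longleftrightarrow> (\<forall>i\<in>{1..t}. s i = s' i)"
  by (auto simp: history_def)

abbreviation arrival_path :: "'z \<Rightarrow> nat \<Rightarrow> nat \<Rightarrow> 'z option" where
  "arrival_path z y \<equiv> (\<lambda>t. if t = y then Some z else None)"

text \<open>After arrival the history shows both the signal and its date; before arrival it consists
  of null signals only and is shared by all arrival dates outside \<open>{1..t}\<close>. The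
  assumption excludes \<open>y = 0\<close>, which satisfies \<open>y \<le> t\<close> but leaves no
  trace in a history starting at period 1.\<close>

lemma history_arrival_path_eq_iff:
  assumes "1 \<le> y"
  shows "history t (arrival_path z' y') = history t (arrival_path z y) \<longleftrightarrow>
    (if y \<le> t then z' = z \<and> y' = y else y' \<notin> {1..t})"
  using assms by (auto simp: history_eq_iff Ball_def split: if_splits)

lemma history_random_arrival:
  "map_pmf (history t) (random_arrival \<xi> q \<theta>) =
    map_pmf (\<lambda>(z, y). history t (arrival_path z y)) (pair_pmf (\<xi> \<theta>) q)"
  by (simp add: random_arrival_def map_pmf_comp case_prod_unfold)

text \<open>By independence of the arrival time, the likelihood of a history depends on
  \<open>\<theta>\<close> only through \<open>pmf (\<xi> \<theta>) z\<close>, and not at all before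
  arrival. This is the form that \<open>posterior_proportional\<close> asks for.\<close>

lemma pmf_history_random_arrival:
  assumes "1 \<le> y"
  shows "pmf (map_pmf (history t) (random_arrival \<xi> q \<theta>)) (history t (arrival_path z y)) =
    (if y \<le> t then pmf q y * pmf (\<xi> \<theta>) z else measure_pmf.prob q (- {1..t}))"
proof -
  have "(\<lambda>(z', y'). history t (arrival_path z' y')) -` {history t (arrival_path z y)} =
      (if y \<le> t then {(z, y)} else UNIV \<times> (- {1..t}))"
    using history_arrival_path_eq_iff[OF assms, of t _ _ z] by auto
  moreover have "measure_pmf.prob (pair_pmf (\<xi> \<theta>) q) (UNIV \<times> (- {1..t})) = measure_pmf.prob q (- {1..t})"
  proof -
    have "UNIV \<times> (- {1..t}) = snd -` (- {1..t})"
      by auto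
    then show ?thesis
      by (metis map_snd_pair_pmf measure_map_pmf)
  qed
  ultimately show ?thesis
    by (simp add: history_random_arrival pmf_map measure_pmf_single pmf_pair)
qed

lemma posterior_history_random_arrival:
  fixes \<mu> :: "'th::finite pmf"
  assumes "0 \<notin> set_pmf q" "\<theta> \<in> set_pmf \<mu>" "z \<in> set_pmf (\<xi> \<theta>)" "y \<in> set_pmf q"
  shows "posterior \<mu> (\<lambda>\<theta>. map_pmf (history t) (random_arrival \<xi> q \<theta>)) (history t (arrival_path z y)) =
    (if y \<le> t then posterior \<mu> \<xi> z else \<mu>)"
proof -
  let ?\<xi>t = "\<lambda>\<theta>. map_pmf (history t) (random_arrival \<xi> q \<theta>)"
  have y: "1 \<le> y"
    using assms by (cases y) auto
  have s: "history t (arrival_path z y) \<in> set_pmf (map_pmf (history t) (random_arrival \<xi> q \<theta>))"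
    unfolding history_random_arrival set_map_pmf using assms by (intro image_eqI[of _ _ "(z, y)"]) auto
  show ?thesis
  proof (cases "y \<le> t")
    case True
    then show ?thesis
      using posterior_proportional[OF assms(2), of "history t (arrival_path z y)" ?\<xi>t "pmf q y" \<xi> z] s pmf_history_random_arrival[OF y, of t \<xi> q]
      by simp
  next
    case False
    \<comment> \<open>A null history has the same likelihood in all states, so it is compared with
      the one-valued signal \<open>()\<close>, whose posterior is the prior.\<close>
    then show ?thesis
      using posterior_proportional[OF assms(2), of "history t (arrival_path z y)" ?\<xi>t "measure_pmf.prob q (- {1..t})"
          "\<lambda>_. return_pmf ()" "()"] s
        pmf_history_random_arrival[OF y, of t \<xi> q] posterior_uninformative[of \<mu> "()"]
      by simp
  qed
qed

lemma posterior_law_alt: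
  "posterior_law \<mu> \<xi> = bind_pmf \<mu> (\<lambda>\<theta>. map_pmf (posterior \<mu> \<xi>) (\<xi> \<theta>))"
  by (simp add: posterior_law_def joint_law_def map_bind_pmf map_pmf_comp)

text \<open>The arrival time enters the posterior only through \<open>y \<le> t\<close>, so drawing
  it first exhibits the belief law as a mixture. Mixing over a Boolean keeps the mixing variable
  finite even if \<open>q\<close> has infinite support.\<close>

lemma belief_law_random_arrival:
  fixes \<mu> :: "'th::finite pmf"
  assumes "0 \<notin> set_pmf q"
  shows "belief_law \<mu> (random_arrival \<xi> q) t =
    bind_pmf (map_pmf (\<lambda>y. y \<le> t) q) (\<lambda>b. if b then posterior_law \<mu> \<xi> else return_pmf \<mu>)"
proof -
  let ?post = "posterior \<mu> (\<lambda>\<theta>. map_pmf (history t) (random_arrival \<xi> q \<theta>))"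
  have "belief_law \<mu> (random_arrival \<xi> q) t =
      bind_pmf \<mu> (\<lambda>\<theta>. map_pmf (\<lambda>(z, y). ?post (history t (arrival_path z y))) (pair_pmf (\<xi> \<theta>) q))"
    by (simp add: belief_law_def posterior_law_alt)
       (simp add: history_random_arrival map_pmf_comp case_prod_unfold)
  also have "\<dots> = bind_pmf \<mu> (\<lambda>\<theta>. map_pmf (\<lambda>(z, y). if y \<le> t then posterior \<mu> \<xi> z else \<mu>) (pair_pmf (\<xi> \<theta>) q))"
    using assms by (intro bind_pmf_cong refl map_pmf_cong)
      (auto simp: posterior_history_random_arrival)
  \<comment> \<open>The draw of \<open>y\<close> is moved outwards, here past the signal and in the
    next step past the state; neither affects its law.\<close>
  also have "\<dots> = bind_pmf \<mu> (\<lambda>\<theta>. bind_pmf q (\<lambda>y. map_pmf (\<lambda>z. if y \<le> t then posterior \<mu> \<xi> z else \<mu>) (\<xi> \<theta>)))"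
    by (intro bind_pmf_cong refl, simp add: pair_pmf_def map_pmf_def bind_assoc_pmf bind_return_pmf)
       (rule bind_commute_pmf)
  also have "\<dots> = bind_pmf q (\<lambda>y. bind_pmf \<mu> (\<lambda>\<theta>. map_pmf (\<lambda>z. if y \<le> t then posterior \<mu> \<xi> z else \<mu>) (\<xi> \<theta>)))"
    by (rule bind_commute_pmf)
  also have "\<dots> = bind_pmf q (\<lambda>y. if y \<le> t then posterior_law \<mu> \<xi> else return_pmf \<mu>)"
    by (intro bind_pmf_cong refl) (simp add: posterior_law_alt)
  finally show ?thesis
    by (simp add: bind_map_pmf)
qed

lemma finite_set_posterior_law:
  fixes \<mu> :: "'th::finite pmf" and \<xi> :: "'th \<Rightarrow> 's::finite pmf"
  shows "finite (set_pmf (posterior_law \<mu> \<xi>))"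
  by (simp add: posterior_law_def)

lemma expectation_belief_law_random_arrival:
  fixes \<mu> :: "'th::finite pmf" and \<xi> :: "'th \<Rightarrow> 's::finite pmf" and V :: "'th pmf \<Rightarrow> real"
  assumes "0 \<notin> set_pmf q"
  shows "measure_pmf.expectation (belief_law \<mu> (random_arrival \<xi> q) t) V =
    V \<mu> + measure_pmf.prob q {..t} * (measure_pmf.expectation (posterior_law \<mu> \<xi>) V - V \<mu>)"
proof -
  have "measure_pmf.expectation (belief_law \<mu> (random_arrival \<xi> q) t) V =
      (\<Sum>b\<in>UNIV. pmf (map_pmf (\<lambda>y. y \<le> t) q) b *\<^sub>R
        measure_pmf.expectation (if b then posterior_law \<mu> \<xi> else return_pmf \<mu>) V)"
    unfolding belief_law_random_arrival[OF assms]
    by (rule pmf_expectation_bind) (auto simp: finite_set_posterior_law)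
  moreover have "(\<lambda>y. y \<le> t) -` {True} = {..t}" "(\<lambda>y. y \<le> t) -` {False} = UNIV - {..t}"
    by auto
  moreover have "measure_pmf.prob q (UNIV - {..t}) = 1 - measure_pmf.prob q {..t}"
    using measure_pmf.prob_compl[of "{..t}" q] by simp
  ultimately show ?thesis
    by (simp add: UNIV_bool pmf_map algebra_simps)
qed

section \<open>Nonnegative value of information\<close>

lemma expectation_posterior_law:
  fixes \<mu> :: "'th::finite pmf" and \<xi> :: "'th \<Rightarrow> 's::finite pmf"
  shows "measure_pmf.expectation (posterior_law \<mu> \<xi>) (\<lambda>x. pmf x \<theta>) = pmf \<mu> \<theta>"
proof -
  let ?D = "\<lambda>s. \<Sum>\<eta>\<in>UNIV. pmf \<mu> \<eta> * pmf (\<xi> \<eta>) s"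
  \<comment> \<open>Bayes' rule without division: \<open>?D s\<close> is the total probability of
    \<open>s\<close>. In this form it also covers null signals, whose posterior is arbitrary, since
    both sides then vanish.\<close>
  have D: "?D s * pmf (posterior \<mu> \<xi> s) \<theta> = pmf \<mu> \<theta> * pmf (\<xi> \<theta>) s" for s
  proof (cases "\<exists>\<eta>. \<eta> \<in> set_pmf \<mu> \<and> s \<in> set_pmf (\<xi> \<eta>)")
    case True
    then obtain \<eta> where \<eta>: "\<eta> \<in> set_pmf \<mu>" "s \<in> set_pmf (\<xi> \<eta>)"
      by blast
    then have "0 < pmf \<mu> \<eta> * pmf (\<xi> \<eta>) s"
      by (simp add: pmf_positive)
    also have "\<dots> \<le> ?D s"
      by (intro member_le_sum) auto
    finally show ?thesis
      by (simp add: pmf_posterior[of \<eta> \<mu> s \<xi>] \<eta>)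
  next
    case False
    then have zero: "pmf \<mu> \<eta> * pmf (\<xi> \<eta>) s = 0" for \<eta>
      by (auto simp: set_pmf_iff)
    show ?thesis
      unfolding zero by simp
  qed
  have "measure_pmf.expectation (posterior_law \<mu> \<xi>) (\<lambda>x. pmf x \<theta>) =
      (\<Sum>\<omega>\<in>UNIV. pmf (joint_law \<mu> \<xi>) \<omega> * pmf (posterior \<mu> \<xi> (snd \<omega>)) \<theta>)"
    by (simp add: posterior_law_def integral_measure_pmf_real[of UNIV] mult.commute)
  also have "\<dots> = (\<Sum>\<eta>\<in>UNIV. \<Sum>s\<in>UNIV. pmf \<mu> \<eta> * pmf (\<xi> \<eta>) s * pmf (posterior \<mu> \<xi> s) \<theta>)"
    by (simp add: sum.cartesian_product pmf_joint_law case_prod_unfold flip: UNIV_Times_UNIV)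
       (metis (no_types, lifting) pmf_joint_law prod.collapse)
  also have "\<dots> = (\<Sum>s\<in>UNIV. ?D s * pmf (posterior \<mu> \<xi> s) \<theta>)"
    by (subst sum.swap) (simp add: sum_distrib_right)
  also have "\<dots> = pmf \<mu> \<theta>"
    by (simp add: D sum_pmf_eq_1 flip: sum_distrib_left)
  finally show ?thesis .
qed

lemma bdd_above_decision_problem:
  fixes v :: "'a::topological_space \<Rightarrow> 'th::finite \<Rightarrow> real"
  assumes "decision_problem A v"
  shows "bdd_above ((\<lambda>a. \<Sum>\<theta>\<in>UNIV. pmf x \<theta> * v a \<theta>) ` A)"
proof -
  have "compact ((\<lambda>a. \<Sum>\<theta>\<in>UNIV. pmf x \<theta> * v a \<theta>) ` A)"
    using assms by (intro compact_continuous_image continuous_intros) (auto simp: decision_problem_def)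
  then show ?thesis
    by (intro bounded_imp_bdd_above compact_imp_bounded)
qed

text \<open>Jensen's inequality for a supremum of linear functions: a fixed action has a payoff
  linear in the belief, so its expectation over posteriors is its payoff at the prior, and the
  indirect utility dominates it pointwise. Finite support of the posterior law settles
  integrability.\<close>

lemma indirect_utility_prior_le:
  fixes \<mu> :: "'th::finite pmf" and \<xi> :: "'th \<Rightarrow> 's::finite pmf"
    and v :: "'a::topological_space \<Rightarrow> 'th \<Rightarrow> real"
  assumes "decision_problem A v"
  shows "indirect_utility A v \<mu> \<le> measure_pmf.expectation (posterior_law \<mu> \<xi>) (indirect_utility A v)"
  unfolding indirect_utility_def[of A v \<mu>]
proof (rule cSUP_least)
  show "A \<noteq> {}"
    using assms by (simp add: decision_problem_def)
next
  fix a assume a: "a \<in> A"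
  note int = integrable_measure_pmf_finite[OF finite_set_posterior_law[of \<mu> \<xi>]]
  have "(\<Sum>\<theta>\<in>UNIV. pmf \<mu> \<theta> * v a \<theta>) =
      measure_pmf.expectation (posterior_law \<mu> \<xi>) (\<lambda>x. \<Sum>\<theta>\<in>UNIV. pmf x \<theta> * v a \<theta>)"
    by (simp add: int expectation_posterior_law)
  also have "\<dots> \<le> measure_pmf.expectation (posterior_law \<mu> \<xi>) (indirect_utility A v)"
    using bdd_above_decision_problem[OF assms] a
    by (intro integral_mono int) (auto simp: indirect_utility_def intro!: cSUP_upper)
  finally show "(\<Sum>\<theta>\<in>UNIV. pmf \<mu> \<theta> * v a \<theta>) \<le> \<dots>" .
qed

section \<open>Mean-preserving spreads and cumulated cdfs\<close>

lemma distr_eq_arrival_law: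
  assumes "prob_space M" "Y \<in> borel_measurable M" "cdf (distr M borel Y) = arrival_cdf q"
  shows "distr M borel Y = distr (measure_pmf q) borel real"
  using assms unfolding arrival_cdf_def
  by (intro cdf_unique) (auto intro!: prob_space.real_distribution_distr prob_space_measure_pmf)

text \<open>Arrival times are nonnegative integers, so the shortfall below \<open>k\<close> lies
  between 0 and \<open>k\<close> and counts the dates \<open>t < k\<close> with
  \<open>y \<le> t\<close>; in expectation each such indicator becomes a cdf value. The computation
  passes through the law of \<open>Y\<close>, as \<open>Y\<close> is tied to \<open>q\<close> only
  in distribution.\<close>

lemma expected_shortfall_arrival:
  fixes Y :: "'w \<Rightarrow> real"
  assumes "prob_space M" and Y: "Y \<in> borel_measurable M" and "cdf (distr M borel Y) = arrival_cdf q"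
  shows "integrable M (\<lambda>\<omega>. max 0 (real k - Y \<omega>))"
    and "(\<integral>\<omega>. max 0 (real k - Y \<omega>) \<partial>M) = (\<Sum>t<k. measure_pmf.prob q {..t})"
proof -
  note eq = distr_eq_arrival_law[OF assms]
  have q: "integrable (measure_pmf q) (\<lambda>y. max 0 (real k - real y))"
    by (rule measure_pmf.integrable_const_bound[where B = "real k"]) auto
  then have "integrable (distr (measure_pmf q) borel real) (\<lambda>x. max 0 (real k - x))"
    by (simp add: integrable_distr_eq)
  then show "integrable M (\<lambda>\<omega>. max 0 (real k - Y \<omega>))"
    using Y by (simp add: integrable_distr_eq flip: eq)
  have count: "max 0 (real k - real y) = (\<Sum>t<k. indicator {..t} y)" for y
  proof -
    have "(\<Sum>t<k. indicator {..t} y :: real) = real (card {t\<in>{..<k}. y \<le> t})"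
      by (simp add: indicator_def sum.If_cases Int_def)
    also have "{t\<in>{..<k}. y \<le> t} = {y..<k}"
      by auto
    finally show ?thesis
      by simp
  qed
  have "(\<integral>\<omega>. max 0 (real k - Y \<omega>) \<partial>M) = (\<integral>x. max 0 (real k - x) \<partial>distr M borel Y)"
    using Y by (simp add: integral_distr)
  also have "\<dots> = measure_pmf.expectation q (\<lambda>y. max 0 (real k - real y))"
    unfolding eq by (simp add: integral_distr)
  also have "\<dots> = (\<Sum>t<k. measure_pmf.prob q {..t})"
    unfolding count by (subst Bochner_Integration.integral_sum) (auto intro: measure_pmf.integrable_const_bound[where B = 1])
  finally show "(\<integral>\<omega>. max 0 (real k - Y \<omega>) \<partial>M) = (\<Sum>t<k. measure_pmf.prob q {..t})" .
qed

text \<open>The shortfall below \<open>k\<close> is convex, so at \<open>Y1\<close> it lies above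
  its supporting line at \<open>Y2\<close>; the linear term in \<open>W\<close> has mean zero
  because its slope is a function of \<open>Y2\<close>.\<close>

lemma second_order_dominates_cumulative_cdf_le:
  assumes "second_order_dominates TYPE('w) (arrival_cdf p) (arrival_cdf h)"
  shows "(\<Sum>t<k. measure_pmf.prob p {..t}) \<le> (\<Sum>t<k. measure_pmf.prob h {..t})"
proof -
  obtain M :: "'w measure" and Y1 Y2 W where M: "prob_space M"
    and Y1: "Y1 \<in> borel_measurable M" "cdf (distr M borel Y1) = arrival_cdf h"
    and Y2: "Y2 \<in> borel_measurable M" "cdf (distr M borel Y2) = arrival_cdf p"
    and W: "integrable M W"
    and sum: "AE \<omega> in M. Y1 \<omega> = Y2 \<omega> + W \<omega>"
    and cond: "AE \<omega> in M. real_cond_exp M (vimage_algebra (space M) Y2 borel) W \<omega> = 0"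
    using assms unfolding second_order_dominates_def by blast
  interpret prob_space M by (rule M)
  let ?F = "vimage_algebra (space M) Y2 borel"
  have sub: "subalgebra M ?F"
    using Y2(1) by (auto simp: subalgebra_def sets_vimage_algebra2 measurable_def)
  interpret finite_measure_subalgebra M ?F
    by standard (rule sub)
  \<comment> \<open>\<open>- ?g\<close> is a subgradient of \<open>max 0 (real k - y)\<close> at
    \<open>y = Y2 \<omega>\<close>; at the kink the slope -1 is chosen.\<close>
  let ?g = "\<lambda>\<omega>. indicator {..real k} (Y2 \<omega>) :: real"
  have gF: "?g \<in> borel_measurable ?F"
    by (intro measurable_compose[OF measurable_vimage_algebra1] borel_measurable_indicator) auto
  have gM [measurable]: "?g \<in> borel_measurable M"
    using Y2(1) by measurable
  have gW: "integrable M (\<lambda>\<omega>. ?g \<omega> * W \<omega>)"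
    using W gM borel_measurable_integrable[OF W]
    by (intro Bochner_Integration.integrable_bound[OF W] borel_measurable_times) (auto simp: indicator_def)
  \<comment> \<open>Since \<open>?g\<close> is measurable with respect to the sigma-algebra of
    \<open>Y2\<close>, \<open>W\<close> may be replaced by its conditional expectation.\<close>
  have "(\<integral>\<omega>. ?g \<omega> * W \<omega> \<partial>M) = (\<integral>\<omega>. ?g \<omega> * real_cond_exp M ?F W \<omega> \<partial>M)"
    using real_cond_exp_intg(2)[OF gW gF] W by simp
  also have "\<dots> = 0"
    using cond by (intro integral_eq_zero_AE) auto
  finally have zero: "(\<integral>\<omega>. ?g \<omega> * W \<omega> \<partial>M) = 0" .
  note i1 = expected_shortfall_arrival[OF M Y1, of k]
  note i2 = expected_shortfall_arrival[OF M Y2, of k]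
  have "(\<integral>\<omega>. max 0 (real k - Y2 \<omega>) - ?g \<omega> * W \<omega> \<partial>M) \<le> (\<integral>\<omega>. max 0 (real k - Y1 \<omega>) \<partial>M)"
  proof (intro integral_mono_AE)
    show "AE \<omega> in M. max 0 (real k - Y2 \<omega>) - ?g \<omega> * W \<omega> \<le> max 0 (real k - Y1 \<omega>)"
      using sum by eventually_elim (auto simp: indicator_def max_def)
  qed (use i1 i2 gW in auto)
  then show ?thesis
    using i1 i2 gW zero by simp
qed

section \<open>Discounted sums over the periods\<close>

lemma geometric_weighted_sum_nonneg:
  fixes \<delta> :: real
  assumes "0 \<le> \<delta>" "\<delta> \<le> 1" and nonneg: "\<And>k. 0 \<le> (\<Sum>i<k. d i)"
  shows "0 \<le> (\<Sum>i<N. \<delta> ^ i * d i)"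
proof -
  \<comment> \<open>Summation by parts as an induction with a stronger claim: since partial sums are
    nonnegative, lowering their weight from \<open>\<delta> ^ N\<close> to
    \<open>\<delta> ^ Suc N\<close> can only decrease the left side.\<close>
  have "\<delta> ^ N * (\<Sum>i<N. d i) \<le> (\<Sum>i<N. \<delta> ^ i * d i)"
  proof (induction N)
    case (Suc N)
    have "\<delta> ^ Suc N * (\<Sum>i<Suc N. d i) \<le> \<delta> ^ N * (\<Sum>i<Suc N. d i)"
      using assms by (intro mult_right_mono nonneg power_decreasing) auto
    also have "\<dots> \<le> (\<Sum>i<Suc N. \<delta> ^ i * d i)"
      using Suc by (simp add: algebra_simps)
    finally show ?case .
  qed simp
  moreover have "0 \<le> \<delta> ^ N * (\<Sum>i<N. d i)"
    using assms by simp
  ultimately show ?thesis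
    by linarith
qed

lemma periods_eq_image: "periods T = Suc ` {n. enat n < T}"
proof (intro equalityI subsetI)
  fix t assume "t \<in> periods T"
  then show "t \<in> Suc ` {n. enat n < T}"
    by (intro image_eqI[of _ _ "t - 1"]) (cases T; auto simp: periods_def)+
next
  fix t assume "t \<in> Suc ` {n. enat n < T}"
  then show "t \<in> periods T"
    by (cases T) (auto simp: periods_def)
qed

text \<open>The summands need not be ordered termwise, only the partial sums are. A finite horizon
  is itself a partial sum; for an infinite one the inequality passes to the limit, where summability
  identifies \<open>infsum\<close> with the limit of partial sums.\<close>

lemma infsum_periods_mono:
  fixes f g :: "nat \<Rightarrow> real"
  assumes f: "f summable_on periods T" and g: "g summable_on periods T"
    and le: "\<And>N. (\<Sum>i<N. f (Suc i)) \<le> (\<Sum>i<N. g (Suc i))"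
  shows "infsum f (periods T) \<le> infsum g (periods T)"
proof (cases T)
  case (enat n)
  then have "periods T = Suc ` {..<n}"
    by (auto simp: periods_eq_image)
  then show ?thesis
    using le[of n] by (simp add: sum.reindex)
next
  case infinity
  then have T: "periods T = range Suc"
    by (auto simp: periods_eq_image)
  have "(\<lambda>i. F (Suc i)) sums infsum F (periods T)" if "F summable_on periods T" for F :: "nat \<Rightarrow> real"
    using has_sum_infsum[OF that] unfolding T
    by (intro has_sum_imp_sums) (simp add: has_sum_reindex comp_def)
  from this[OF f] this[OF g] show ?thesis
    unfolding sums_def by (rule LIMSEQ_le) (use le in auto)
qed

lemma summable_on_discounted:
  fixes c :: "nat \<Rightarrow> real"
  assumes "0 \<le> \<delta>" and "T = \<infinity> \<Longrightarrow> \<delta> < 1" and bound: "\<And>t. \<bar>c t\<bar> \<le> B"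
  shows "(\<lambda>t. \<delta> ^ (t - 1) * c t) summable_on periods T"
proof (cases T)
  case (enat n)
  then show ?thesis
    by (auto simp: periods_eq_image intro!: summable_on_finite)
next
  case infinity
  then have "\<delta> < 1" and T: "periods T = range Suc"
    using assms by (auto simp: periods_eq_image)
  have "(\<lambda>i. \<delta> ^ i * c (Suc i)) summable_on UNIV"
  proof (rule norm_summable_imp_summable_on, rule summable_comparison_test')
    show "summable (\<lambda>i. \<delta> ^ i * B)"
      using \<open>0 \<le> \<delta>\<close> \<open>\<delta> < 1\<close> by (intro summable_mult2 summable_geometric) simp
    show "norm (norm (\<delta> ^ i * c (Suc i))) \<le> \<delta> ^ i * B" for i
      using \<open>0 \<le> \<delta>\<close> bound by (simp add: abs_mult mult_left_mono)
  qed
  then show ?thesis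
    unfolding T by (simp add: summable_on_reindex comp_def)
qed

theorem corollary4p6:
  fixes \<mu> :: "'th::finite pmf"
    and \<xi> :: "'th \<Rightarrow> 'z::finite pmf"
    and T :: enat
    and \<delta> :: real
    and h p :: "nat pmf"
    and H P :: "real \<Rightarrow> real"
    and \<pi>1 \<pi>2 :: "('th, 'z option) dynamic_info"
  assumes "1 \<le> T"
    and "set_pmf \<mu> = UNIV"
    and "0 \<le> \<delta>" and "\<delta> \<le> 1" and "T = \<infinity> \<Longrightarrow> \<delta> < 1"
    and "nontrivial_info \<mu> \<xi>"
    and "set_pmf h \<subseteq> periods T" and "H = arrival_cdf h"
    and "set_pmf p \<subseteq> periods T" and "P = arrival_cdf p"
    and "\<pi>1 = random_arrival \<xi> h"
    and "\<pi>2 = random_arrival \<xi> p"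
    and "second_order_dominates TYPE('w) P H"
  shows "\<forall>(A :: 'a::topological_space set) (v :: 'a \<Rightarrow> 'th \<Rightarrow> real).
           decision_problem A v \<longrightarrow>
             discounted_value \<mu> T \<delta> A v \<pi>1 \<ge> discounted_value \<mu> T \<delta> A v \<pi>2"
proof (intro allI impI)
  fix A :: "'a set" and v :: "'a \<Rightarrow> 'th \<Rightarrow> real"
  assume dp: "decision_problem A v"
  define V where "V = indirect_utility A v"
  define C where "C = measure_pmf.expectation (posterior_law \<mu> \<xi>) V - V \<mu>"
  \<comment> \<open>\<open>c q t\<close> is the expected indirect utility in period \<open>t\<close>
    when the arrival time has law \<open>q\<close>, and \<open>C\<close> is the gain from observing
    the signal.\<close>
  define c where "c = (\<lambda>(q :: nat pmf) t. V \<mu> + measure_pmf.prob q {..t} * C)"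
  have "0 \<le> C"
    using indirect_utility_prior_le[OF dp, of \<mu> \<xi>] by (simp add: C_def V_def)
  have zero: "0 \<notin> set_pmf h" "0 \<notin> set_pmf p"
    using \<open>set_pmf h \<subseteq> periods T\<close> \<open>set_pmf p \<subseteq> periods T\<close> by (auto simp: periods_def)
  have val: "discounted_value \<mu> T \<delta> A v (random_arrival \<xi> q) =
      (\<Sum>\<^sub>\<infinity>t\<in>periods T. \<delta> ^ (t - 1) * c q t)" if "0 \<notin> set_pmf q" for q
    using that by (simp add: discounted_value_def c_def C_def V_def expectation_belief_law_random_arrival)
  have bound: "\<bar>c q t\<bar> \<le> \<bar>V \<mu>\<bar> + C" for q t
  proof -
    have "measure_pmf.prob q {..t} * C \<le> 1 * C"
      using \<open>0 \<le> C\<close> by (intro mult_right_mono) auto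
    moreover have "0 \<le> measure_pmf.prob q {..t} * C"
      using \<open>0 \<le> C\<close> by simp
    ultimately show ?thesis
      unfolding c_def by linarith
  qed
  have summable: "(\<lambda>t. \<delta> ^ (t - 1) * c q t) summable_on periods T" for q
    using assms(3,5) bound by (rule summable_on_discounted)
  have "(\<Sum>\<^sub>\<infinity>t\<in>periods T. \<delta> ^ (t - 1) * c p t) \<le> (\<Sum>\<^sub>\<infinity>t\<in>periods T. \<delta> ^ (t - 1) * c h t)"
  proof (rule infsum_periods_mono[OF summable summable])
    fix N
    let ?d = "\<lambda>i. measure_pmf.prob h {..Suc i} - measure_pmf.prob p {..Suc i}"
    have "0 \<le> (\<Sum>i<k. ?d i)" for k
    proof -
      have "second_order_dominates TYPE('w) (arrival_cdf p) (arrival_cdf h)"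
        using assms by simp
      \<comment> \<open>The cumulated cdfs start at date 0, where both vanish because arrival
        happens in period 1 or later. Taking \<open>Suc k\<close> terms and dropping that one leaves
        periods 1 to \<open>k\<close>.\<close>
      from second_order_dominates_cumulative_cdf_le[OF this, of "Suc k"] show ?thesis
        using zero unfolding sum.lessThan_Suc_shift
        by (simp add: sum_subtractf measure_pmf_single set_pmf_iff)
    qed
    then have "0 \<le> C * (\<Sum>i<N. \<delta> ^ i * ?d i)"
      using \<open>0 \<le> C\<close> assms(3,4) by (intro mult_nonneg_nonneg geometric_weighted_sum_nonneg)
    \<comment> \<open>The constant \<open>V \<mu>\<close> cancels in the difference of the two
      values.\<close>
    also have "\<dots> = (\<Sum>i<N. \<delta> ^ (Suc i - 1) * c h (Suc i)) - (\<Sum>i<N. \<delta> ^ (Suc i - 1) * c p (Suc i))"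
      by (simp add: c_def sum_distrib_left algebra_simps flip: sum_subtractf)
    finally show "(\<Sum>i<N. \<delta> ^ (Suc i - 1) * c p (Suc i)) \<le> (\<Sum>i<N. \<delta> ^ (Suc i - 1) * c h (Suc i))"
      by simp
  qed
  then show "discounted_value \<mu> T \<delta> A v \<pi>1 \<ge> discounted_value \<mu> T \<delta> A v \<pi>2"
    using val zero assms(11,12) by simp
qed

end
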